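(* Let $n\ge 1$. The multiplicative semigroup $(A^+(B_n),\circ)$ is orthodox, i.e. it is a regular semigroup whose set of idempotents is a subsemigroup.
   Context: For $n\ge 1$ let $[n]=\{1,\dots,n\}$. The Brandt semigroup $(B_n,+)$ has underlying set $B_n=([n]\times[n])\cup\{\vartheta\}$ with $(i,j)+(k,l)=(i,l)$ if $j=k$, $(i,j)+(k,l)=\vartheta$ if $j\ne k$, and $\alpha+\vartheta=\vartheta+\alpha=\vartheta$ for all $\alpha\in B_n$. $M(B_n)$ is the set of all maps $B_n\to B_n$; arguments are written on the left of functions. It carries pointwise addition $\alpha(f+g)=\alpha f+\alpha g$ and composition $\alpha(f\circ g)=(\alpha f)g$. An affine map over $B_n$ is a map of the form $g+h$ with $g$ an endomorphism of the semigroup $(B_n,+)$ (not required to fix $\vartheta$) and $h\in M(B_n)$ a constant map. $A^+(B_n)$ (the affine near-semiring over $B_n$) is the smallest subset of $M(B_n)$ that contains all affine maps and is closed under $+$ and $\circ$. *)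

theory Defs
  imports "HOL-Library.FuncSet"
begin

definition semigroup_on :: "'a set \<Rightarrow> ('a \<Rightarrow> 'a \<Rightarrow> 'a) \<Rightarrow> bool" where
  "semigroup_on S m \<longleftrightarrow>
     S \<noteq> {} \<and>
     (\<forall>a\<in>S. \<forall>b\<in>S. m a b \<in> S) \<and>
     (\<forall>a\<in>S. \<forall>b\<in>S. \<forall>c\<in>S. m (m a b) c = m a (m b c))"

definition subsemigroup_of :: "'a set \<Rightarrow> 'a set \<Rightarrow> ('a \<Rightarrow> 'a \<Rightarrow> 'a) \<Rightarrow> bool" where
  "subsemigroup_of T S m \<longleftrightarrow> T \<noteq> {} \<and> T \<subseteq> S \<and> (\<forall>a\<in>T. \<forall>b\<in>T. m a b \<in> T)"

definition regular_semigroup :: "'a set \<Rightarrow> ('a \<Rightarrow> 'a \<Rightarrow> 'a) \<Rightarrow> bool" where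
  "regular_semigroup S m \<longleftrightarrow>
     semigroup_on S m \<and> (\<forall>a\<in>S. \<exists>x\<in>S. m (m a x) a = a)"

definition idempotents :: "'a set \<Rightarrow> ('a \<Rightarrow> 'a \<Rightarrow> 'a) \<Rightarrow> 'a set" where
  "idempotents S m = {e \<in> S. m e e = e}"

definition orthodox_semigroup :: "'a set \<Rightarrow> ('a \<Rightarrow> 'a \<Rightarrow> 'a) \<Rightarrow> bool" where
  "orthodox_semigroup S m \<longleftrightarrow>
     regular_semigroup S m \<and> subsemigroup_of (idempotents S m) S m"

datatype brandt = Theta | Elt nat nat

fun brandt_add :: "brandt \<Rightarrow> brandt \<Rightarrow> brandt" (infixl "\<oplus>\<^sub>B" 65) where
  "Elt i j \<oplus>\<^sub>B Elt k l = (if j = k then Elt i l else Theta)"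
| "Theta \<oplus>\<^sub>B b = Theta"
| "a \<oplus>\<^sub>B Theta = Theta"

definition B :: "nat \<Rightarrow> brandt set" where
  "B n = insert Theta {Elt i j | i j. i \<in> {1..n} \<and> j \<in> {1..n}}"

text \<open>
  Maps on \<open>B n\<close> are extensional functions, so that equality of maps is HOL equality.
\<close>

definition M :: "nat \<Rightarrow> (brandt \<Rightarrow> brandt) set" where
  "M n = B n \<rightarrow>\<^sub>E B n"

definition pointwise_add :: "nat \<Rightarrow> (brandt \<Rightarrow> brandt) \<Rightarrow> (brandt \<Rightarrow> brandt) \<Rightarrow> (brandt \<Rightarrow> brandt)" where
  "pointwise_add n f g = (\<lambda>x\<in>B n. f x \<oplus>\<^sub>B g x)"

text \<open>
  Arguments are written on the left of maps, so the product of \<open>f\<close> and \<open>g\<close> applies \<open>f\<close> first.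
\<close>

definition left_comp :: "nat \<Rightarrow> (brandt \<Rightarrow> brandt) \<Rightarrow> (brandt \<Rightarrow> brandt) \<Rightarrow> (brandt \<Rightarrow> brandt)" where
  "left_comp n f g = compose (B n) g f"

definition endomorphisms :: "nat \<Rightarrow> (brandt \<Rightarrow> brandt) set" where
  "endomorphisms n = {g \<in> M n. \<forall>x\<in>B n. \<forall>y\<in>B n. g (x \<oplus>\<^sub>B y) = g x \<oplus>\<^sub>B g y}"

definition constant_maps :: "nat \<Rightarrow> (brandt \<Rightarrow> brandt) set" where
  "constant_maps n = {h \<in> M n. \<exists>c\<in>B n. \<forall>x\<in>B n. h x = c}"

definition affine_maps :: "nat \<Rightarrow> (brandt \<Rightarrow> brandt) set" where
  "affine_maps n = {pointwise_add n g h | g h. g \<in> endomorphisms n \<and> h \<in> constant_maps n}"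

inductive_set A_plus :: "nat \<Rightarrow> (brandt \<Rightarrow> brandt) set" for n :: nat where
  affine: "f \<in> affine_maps n \<Longrightarrow> f \<in> A_plus n"
| add: "f \<in> A_plus n \<Longrightarrow> g \<in> A_plus n \<Longrightarrow> pointwise_add n f g \<in> A_plus n"
| comp: "f \<in> A_plus n \<Longrightarrow> g \<in> A_plus n \<Longrightarrow> left_comp n f g \<in> A_plus n"

end

theory Submission
  imports Defs
begin

text \<open>
  An endomorphism of \<open>B n\<close> is constant or of the form \<open>(i,j) \<mapsto> (i\<sigma>, j\<sigma>)\<close> for a permutation
  \<open>\<sigma>\<close>. Adding constants and closing up, every element of \<open>A_plus n\<close> is constant, or supported at
  a single pair, or of the form \<open>(i,k) \<mapsto> (i\<sigma>, p)\<close> on one column \<open>k\<close> and \<open>\<vartheta>\<close> elsewhere. Each of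
  these kinds contains the inverses that regularity asks for. The nonconstant elements fix \<open>\<vartheta>\<close>
  and are injective where they are not \<open>\<vartheta>\<close>, so the idempotents among them are partial
  identities, and these are closed under composition; a product with a constant factor is
  constant, hence idempotent.
\<close>

section \<open>Arithmetic in \<open>B n\<close>, and sums and products of maps on it\<close>

lemma brandt_add_Theta [simp]: "x \<oplus>\<^sub>B Theta = Theta"
  by (cases x) auto

lemma Theta_in_B [simp]: "Theta \<in> B n"
  by (simp add: B_def)

lemma Elt_in_B [simp]: "Elt i j \<in> B n \<longleftrightarrow> i \<in> {1..n} \<and> j \<in> {1..n}"
  by (auto simp: B_def)

lemma brandt_add_in_B: "x \<in> B n \<Longrightarrow> y \<in> B n \<Longrightarrow> x \<oplus>\<^sub>B y \<in> B n"
  by (cases x; cases y) auto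

lemma pointwise_add_in_M: "f \<in> M n \<Longrightarrow> g \<in> M n \<Longrightarrow> pointwise_add n f g \<in> M n"
  unfolding M_def pointwise_add_def by (auto intro!: brandt_add_in_B dest: PiE_mem)

lemma left_comp_in_M: "f \<in> M n \<Longrightarrow> g \<in> M n \<Longrightarrow> left_comp n f g \<in> M n"
  unfolding M_def left_comp_def by (auto simp: compose_def dest: PiE_mem)

lemma M_in_B: "f \<in> M n \<Longrightarrow> x \<in> B n \<Longrightarrow> f x \<in> B n"
  unfolding M_def by (rule PiE_mem)

lemma M_eqI: "f \<in> M n \<Longrightarrow> g \<in> M n \<Longrightarrow> (\<And>x. x \<in> B n \<Longrightarrow> f x = g x) \<Longrightarrow> f = g"
  unfolding M_def by (rule PiE_ext)

lemma pointwise_add_apply [simp]: "x \<in> B n \<Longrightarrow> pointwise_add n f g x = f x \<oplus>\<^sub>B g x"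
  by (simp add: pointwise_add_def)

lemma left_comp_apply [simp]: "x \<in> B n \<Longrightarrow> left_comp n f g x = g (f x)"
  by (simp add: left_comp_def compose_def)

lemma left_comp_assoc:
  "f \<in> M n \<Longrightarrow> g \<in> M n \<Longrightarrow> h \<in> M n \<Longrightarrow>
    left_comp n (left_comp n f g) h = left_comp n f (left_comp n g h)"
  by (rule M_eqI) (auto intro: left_comp_in_M simp: M_in_B)

section \<open>The kinds of maps that occur\<close>

definition const_map :: "nat \<Rightarrow> brandt \<Rightarrow> brandt \<Rightarrow> brandt" where
  "const_map n c = (\<lambda>x\<in>B n. c)"

text \<open>For a permutation \<open>\<sigma>\<close> of \<open>{1..n}\<close> this is the induced
  automorphism of the Brandt semigroup.\<close>

definition auto_map :: "nat \<Rightarrow> (nat \<Rightarrow> nat) \<Rightarrow> brandt \<Rightarrow> brandt" where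
  "auto_map n \<sigma> = (\<lambda>x\<in>B n. case x of Theta \<Rightarrow> Theta | Elt i j \<Rightarrow> Elt (\<sigma> i) (\<sigma> j))"

definition point_map :: "nat \<Rightarrow> brandt \<Rightarrow> brandt \<Rightarrow> brandt \<Rightarrow> brandt" where
  "point_map n a b = (\<lambda>x\<in>B n. if x = a then b else Theta)"

text \<open>For a permutation \<open>\<sigma>\<close> and indices \<open>k\<close>, \<open>p\<close>
  in range, column \<open>k\<close> is carried bijectively onto column \<open>p\<close>.\<close>

definition column_map :: "nat \<Rightarrow> nat \<Rightarrow> nat \<Rightarrow> (nat \<Rightarrow> nat) \<Rightarrow> brandt \<Rightarrow> brandt" where
  "column_map n k p \<sigma> =
    (\<lambda>x\<in>B n. case x of Theta \<Rightarrow> Theta | Elt i j \<Rightarrow> if j = k then Elt (\<sigma> i) p else Theta)"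

abbreviation perm_on :: "nat \<Rightarrow> (nat \<Rightarrow> nat) \<Rightarrow> bool" where
  "perm_on n \<sigma> \<equiv> bij_betw \<sigma> {1..n} {1..n}"

lemma perm_on_mem: "perm_on n \<sigma> \<Longrightarrow> i \<in> {1..n} \<Longrightarrow> \<sigma> i \<in> {1..n}"
  by (rule bij_betwE[rule_format])

lemma perm_on_eq_iff:
  "perm_on n \<sigma> \<Longrightarrow> i \<in> {1..n} \<Longrightarrow> j \<in> {1..n} \<Longrightarrow> \<sigma> i = \<sigma> j \<longleftrightarrow> i = j"
  by (metis bij_betw_imp_inj_on inj_on_eq_iff)

lemma perm_on_preimage:
  assumes "perm_on n \<sigma>" "p \<in> {1..n}"
  obtains i where "i \<in> {1..n}" "\<sigma> i = p"
  using assms by (metis bij_betw_imp_surj_on imageE)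

lemma const_map_apply [simp]: "x \<in> B n \<Longrightarrow> const_map n c x = c"
  by (simp add: const_map_def)

lemma point_map_apply [simp]: "x \<in> B n \<Longrightarrow> point_map n a b x = (if x = a then b else Theta)"
  by (simp add: point_map_def)

lemma column_map_Theta [simp]: "column_map n k p \<sigma> Theta = Theta"
  by (simp add: column_map_def)

lemma column_map_Elt [simp]:
  "i \<in> {1..n} \<Longrightarrow> j \<in> {1..n} \<Longrightarrow>
    column_map n k p \<sigma> (Elt i j) = (if j = k then Elt (\<sigma> i) p else Theta)"
  by (simp add: column_map_def)

lemma auto_map_Theta [simp]: "auto_map n \<sigma> Theta = Theta"
  by (simp add: auto_map_def)

lemma auto_map_Elt [simp]:
  "i \<in> {1..n} \<Longrightarrow> j \<in> {1..n} \<Longrightarrow> auto_map n \<sigma> (Elt i j) = Elt (\<sigma> i) (\<sigma> j)"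
  by (simp add: auto_map_def)

lemma const_map_in_M: "c \<in> B n \<Longrightarrow> const_map n c \<in> M n"
  by (auto simp: M_def const_map_def)

lemma point_map_in_M: "b \<in> B n \<Longrightarrow> point_map n a b \<in> M n"
  by (auto simp: M_def point_map_def)

lemma auto_map_in_M: "perm_on n \<sigma> \<Longrightarrow> auto_map n \<sigma> \<in> M n"
  unfolding M_def auto_map_def
  by (rule restrict_PiE_iff[THEN iffD2])
    (auto simp del: One_nat_def atLeastAtMost_iff simp: perm_on_mem split: brandt.split)

lemma column_map_in_M: "perm_on n \<sigma> \<Longrightarrow> p \<in> {1..n} \<Longrightarrow> column_map n k p \<sigma> \<in> M n"
  unfolding M_def column_map_def
  by (rule restrict_PiE_iff[THEN iffD2])
    (auto simp del: One_nat_def atLeastAtMost_iff simp: perm_on_mem split: brandt.split)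

lemma constant_maps_eq: "constant_maps n = const_map n ` B n"
proof (intro equalityI subsetI)
  fix h assume "h \<in> constant_maps n"
  then obtain c where "h \<in> M n" "c \<in> B n" "\<forall>x\<in>B n. h x = c"
    by (auto simp: constant_maps_def)
  then have "h = const_map n c"
    by (intro M_eqI[where n=n]) (auto intro: const_map_in_M)
  then show "h \<in> const_map n ` B n" using \<open>c \<in> B n\<close> by blast
qed (auto simp: constant_maps_def const_map_in_M)

section \<open>Endomorphisms of the Brandt semigroup\<close>

lemma auto_map_endomorphism: "perm_on n \<sigma> \<Longrightarrow> auto_map n \<sigma> \<in> endomorphisms n"
  unfolding endomorphisms_def
proof (safe intro!: auto_map_in_M)
  fix x y assume "perm_on n \<sigma>" "x \<in> B n" "y \<in> B n"
  then show "auto_map n \<sigma> (x \<oplus>\<^sub>B y) = auto_map n \<sigma> x \<oplus>\<^sub>B auto_map n \<sigma> y"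
    by (cases x; cases y) (auto simp: perm_on_eq_iff[of \<sigma> n])
qed

lemma const_map_endomorphism: "c \<in> B n \<Longrightarrow> c \<oplus>\<^sub>B c = c \<Longrightarrow> const_map n c \<in> endomorphisms n"
  by (auto simp: endomorphisms_def const_map_in_M brandt_add_in_B)

lemma brandt_idempotent: "x \<oplus>\<^sub>B x = x \<Longrightarrow> x \<noteq> Theta \<Longrightarrow> \<exists>i. x = Elt i i"
  by (metis brandt.exhaust brandt_add.simps(1))

text \<open>A left identity fixes the first coordinate of a nonzero element, a right identity the
  second. This determines an endomorphism off the diagonal from its values on the diagonal.\<close>

lemma brandt_between_idempotents:
  "Elt i i \<oplus>\<^sub>B x = x \<Longrightarrow> x \<oplus>\<^sub>B Elt j j = x \<Longrightarrow> x \<noteq> Theta \<Longrightarrow> x = Elt i j"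
  by (metis brandt.exhaust brandt_add.simps(1))

text \<open>The split is by where \<open>Theta\<close> arises as a value. If \<open>g\<close> moves
  \<open>Theta\<close>, or sends some pair to \<open>Theta\<close>, absorption forces
  \<open>g\<close> to be constant. Otherwise \<open>g\<close> permutes the diagonal idempotents, and
  these determine all other values.\<close>

lemma endomorphism_cases:
  assumes "g \<in> endomorphisms n"
  obtains c where "c \<in> B n" "g = const_map n c"
  | \<sigma> where "perm_on n \<sigma>" "g = auto_map n \<sigma>"
proof -
  have gM: "g \<in> M n" and hom: "\<And>x y. x \<in> B n \<Longrightarrow> y \<in> B n \<Longrightarrow> g (x \<oplus>\<^sub>B y) = g x \<oplus>\<^sub>B g y"
    using assms by (auto simp: endomorphisms_def)
  have gB: "\<And>x. x \<in> B n \<Longrightarrow> g x \<in> B n" using gM by (rule M_in_B)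
  note shape = that
  have const: thesis if "\<And>x. x \<in> B n \<Longrightarrow> g x = g Theta"
  proof (rule shape(1))
    show "g Theta \<in> B n" by (simp add: gB)
    show "g = const_map n (g Theta)"
      by (rule M_eqI[where n=n]) (auto simp: gM gB const_map_in_M intro: that)
  qed
  show thesis
  proof (cases "g Theta = Theta")
    case False
    then obtain k where k: "g Theta = Elt k k"
      using brandt_idempotent[of "g Theta"] hom[of Theta Theta, symmetric] by auto
    show thesis
    proof (rule const)
      fix x assume "x \<in> B n"
      \<comment> \<open>\<open>Theta\<close> absorbs every \<open>x\<close>, so its image
        \<open>Elt k k\<close> absorbs every \<open>g x\<close> on both sides; only
        \<open>Elt k k\<close> itself is absorbed in this way.\<close>
      then have "g x \<oplus>\<^sub>B Elt k k = Elt k k" "Elt k k \<oplus>\<^sub>B g x = Elt k k"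
        using hom[of x Theta, symmetric] hom[of Theta x, symmetric] k by auto
      then show "g x = g Theta" using k by (cases "g x") (auto split: if_splits)
    qed
  next
    case Theta: True
    show thesis
    proof (cases "\<exists>i\<in>{1..n}. \<exists>j\<in>{1..n}. g (Elt i j) = Theta")
      case True
      then obtain i j where ij: "i \<in> {1..n}" "j \<in> {1..n}" "g (Elt i j) = Theta" by auto
      show thesis
      proof (rule const)
        fix x assume x: "x \<in> B n"
        show "g x = g Theta"
        proof (cases x)
          case (Elt r s)
          \<comment> \<open>Every pair factors through \<open>Elt i j\<close>, so its image has the
            factor \<open>Theta\<close>.\<close>
          then have "g (Elt r i \<oplus>\<^sub>B Elt i j \<oplus>\<^sub>B Elt j s) = g (Elt r i \<oplus>\<^sub>B Elt i j) \<oplus>\<^sub>B g (Elt j s)"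
            using ij x by (intro hom) auto
          also have "g (Elt r i \<oplus>\<^sub>B Elt i j) = g (Elt r i) \<oplus>\<^sub>B g (Elt i j)"
            using ij x Elt by (intro hom) auto
          finally show ?thesis using ij Elt Theta by simp
        qed simp
      qed
    next
      case nz: False
      have "\<exists>r. g (Elt i i) = Elt r r" if "i \<in> {1..n}" for i
        using brandt_idempotent[of "g (Elt i i)"] hom[of "Elt i i" "Elt i i", symmetric] nz that by auto
      then obtain \<sigma> where \<sigma>: "\<And>i. i \<in> {1..n} \<Longrightarrow> g (Elt i i) = Elt (\<sigma> i) (\<sigma> i)"
        by metis
      \<comment> \<open>Distinct diagonal idempotents sum to \<open>Theta\<close>, while equal
        images would have a nonzero sum.\<close>
      have inj: "inj_on \<sigma> {1..n}"
      proof (rule inj_onI, rule ccontr)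
        fix i j assume "i \<in> {1..n}" "j \<in> {1..n}" "\<sigma> i = \<sigma> j" "i \<noteq> j"
        then show False using hom[of "Elt i i" "Elt j j"] \<sigma> Theta by auto
      qed
      have "\<sigma> ` {1..n} \<subseteq> {1..n}"
        using \<sigma> gB by (metis Elt_in_B image_subsetI)
      \<comment> \<open>An injective map of a finite set into itself is onto.\<close>
      then have perm: "perm_on n \<sigma>"
        using inj by (simp add: bij_betw_def endo_inj_surj)
      have off: "g (Elt i j) = Elt (\<sigma> i) (\<sigma> j)" if "i \<in> {1..n}" "j \<in> {1..n}" for i j
      proof -
        have "Elt (\<sigma> i) (\<sigma> i) \<oplus>\<^sub>B g (Elt i j) = g (Elt i j)"
          "g (Elt i j) \<oplus>\<^sub>B Elt (\<sigma> j) (\<sigma> j) = g (Elt i j)"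
          using hom[of "Elt i i" "Elt i j", symmetric] hom[of "Elt i j" "Elt j j", symmetric] \<sigma> that by auto
        then show ?thesis using nz that by (intro brandt_between_idempotents) auto
      qed
      have "g = auto_map n \<sigma>"
      proof (rule M_eqI[OF gM auto_map_in_M[OF perm]])
        fix x assume "x \<in> B n"
        then show "g x = auto_map n \<sigma> x" using Theta off by (cases x) auto
      qed
      with perm show thesis by (rule shape(2))
    qed
  qed
qed

section \<open>Closure of the three kinds of maps under sum and composition\<close>

inductive_set shapes :: "nat \<Rightarrow> (brandt \<Rightarrow> brandt) set" for n where
  const: "c \<in> B n \<Longrightarrow> const_map n c \<in> shapes n"
| point: "a \<in> B n \<Longrightarrow> a \<noteq> Theta \<Longrightarrow> b \<in> B n \<Longrightarrow> point_map n a b \<in> shapes n"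
| column: "k \<in> {1..n} \<Longrightarrow> p \<in> {1..n} \<Longrightarrow> perm_on n \<sigma> \<Longrightarrow> column_map n k p \<sigma> \<in> shapes n"

lemma shapes_in_M: "f \<in> shapes n \<Longrightarrow> f \<in> M n"
  by (erule shapes.cases) (auto intro: const_map_in_M point_map_in_M column_map_in_M)

lemma shapes_constI:
  "f \<in> M n \<Longrightarrow> (\<And>x. x \<in> B n \<Longrightarrow> f x = c) \<Longrightarrow> f \<in> shapes n"
  by (metis M_eqI M_in_B Theta_in_B const_map_apply const_map_in_M shapes.const)

text \<open>The value at \<open>a\<close> is unrestricted: since \<open>point_map\<close> may take
  the value \<open>Theta\<close>, it suffices to bound the support by one point.\<close>

lemma shapes_pointI:
  assumes "f \<in> M n" "a \<in> B n" "a \<noteq> Theta" "\<And>x. x \<in> B n \<Longrightarrow> x \<noteq> a \<Longrightarrow> f x = Theta"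
  shows "f \<in> shapes n"
proof -
  have "f = point_map n a (f a)"
    using assms by (intro M_eqI[where n=n]) (auto intro: point_map_in_M M_in_B)
  with assms show ?thesis by (metis M_in_B shapes.point)
qed

lemma shapes_columnI:
  assumes "f \<in> M n" "k \<in> {1..n}" "p \<in> {1..n}" "perm_on n \<sigma>"
    "\<And>x. x \<in> B n \<Longrightarrow> f x = column_map n k p \<sigma> x"
  shows "f \<in> shapes n"
  using assms by (metis M_eqI column_map_in_M shapes.column)

text \<open>Since \<open>Theta\<close> absorbs, a summand supported at a point keeps the sum there.
  A constant to the left of a column map, or a column map to the left of another, must match a first
  coordinate, which the permutation attains only once. A constant to the right of a column map only
  changes the target column or annihilates the map.\<close>

lemma shapes_add:
  assumes f: "f \<in> shapes n" and g: "g \<in> shapes n"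
  shows "pointwise_add n f g \<in> shapes n"
proof -
  have fg: "pointwise_add n f g \<in> M n"
    using f g by (intro pointwise_add_in_M shapes_in_M)
  show ?thesis
    using f
  proof cases
    case (point a b)
    then show ?thesis by (intro shapes_pointI[OF fg, of a]) auto
  next
    case c: (const c)
    show ?thesis
      using g
    proof cases
      case (const d)
      with c show ?thesis by (intro shapes_constI[OF fg, of "c \<oplus>\<^sub>B d"]) auto
    next
      case (point a b)
      then show ?thesis by (intro shapes_pointI[OF fg, of a]) auto
    next
      case g: (column k p \<sigma>)
      show ?thesis
      proof (cases c)
        case Theta
        with c show ?thesis by (intro shapes_constI[OF fg, of Theta]) auto
      next
        case (Elt r s)
        then obtain i where i: "i \<in> {1..n}" "\<sigma> i = s"
          using c g perm_on_preimage[of \<sigma> n s] by auto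
        show ?thesis
        proof (rule shapes_pointI[OF fg, of "Elt i k"])
          fix x assume "x \<in> B n" "x \<noteq> Elt i k"
          then show "pointwise_add n f g x = Theta"
            using c g Elt i by (cases x) (auto simp: perm_on_eq_iff[of \<sigma> n])
        qed (use g i in auto)
      qed
    qed
  next
    case f: (column k p \<sigma>)
    show ?thesis
      using g
    proof cases
      case (point a b)
      then show ?thesis by (intro shapes_pointI[OF fg, of a]) auto
    next
      case c: (const c)
      show ?thesis
      proof (cases "\<exists>q. c = Elt p q")
        case True
        then obtain q where q: "c = Elt p q" by blast
        show ?thesis
        proof (rule shapes_columnI[OF fg, of k q \<sigma>])
          fix x assume "x \<in> B n"
          then show "pointwise_add n f g x = column_map n k q \<sigma> x"
            using c f q by (cases x) auto
        qed (use c f q in auto)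
      next
        case False
        show ?thesis
        proof (rule shapes_constI[OF fg, of Theta])
          fix x assume "x \<in> B n"
          then show "pointwise_add n f g x = Theta"
            using c f False by (cases x; cases c) auto
        qed
      qed
    next
      case g: (column l q \<tau>)
      \<comment> \<open>The first summand ends in \<open>p\<close>, so the row \<open>i\<close> must
        satisfy \<open>\<tau> i = p\<close>. If \<open>k\<close> and \<open>l\<close> differ, the
        sum vanishes at \<open>Elt i k\<close> as well.\<close>
      obtain i where i: "i \<in> {1..n}" "\<tau> i = p"
        using f g perm_on_preimage[of \<tau> n p] by auto
      show ?thesis
      proof (rule shapes_pointI[OF fg, of "Elt i k"])
        fix x assume "x \<in> B n" "x \<noteq> Elt i k"
        then show "pointwise_add n f g x = Theta"
          using f g i by (cases x) (auto simp: perm_on_eq_iff[of \<tau> n])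
      qed (use f i in auto)
    qed
  qed
qed

text \<open>A constant second factor gives a constant. Any other second factor fixes
  \<open>Theta\<close>, so the support cannot grow; two column maps compose to a column map when the
  target column of the first is the source column of the second, and to zero otherwise.\<close>

lemma shapes_comp:
  assumes f: "f \<in> shapes n" and g: "g \<in> shapes n"
  shows "left_comp n f g \<in> shapes n"
proof -
  have fM: "f \<in> M n" using f by (rule shapes_in_M)
  have fg: "left_comp n f g \<in> M n"
    using f g by (intro left_comp_in_M shapes_in_M)
  show ?thesis
  proof (cases "g \<in> const_map n ` B n")
    case True
    then obtain c where "g = const_map n c" by blast
    then show ?thesis by (intro shapes_constI[OF fg, of c]) (auto simp: M_in_B[OF fM])
  next
    case False
    have gT: "g Theta = Theta" using g by cases (use False in auto)
    show ?thesis
      using f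
    proof cases
      case (const c)
      then show ?thesis by (intro shapes_constI[OF fg, of "g c"]) auto
    next
      case (point a b)
      then show ?thesis using gT by (intro shapes_pointI[OF fg, of a]) auto
    next
      case f: (column k p \<sigma>)
      show ?thesis
        using g
      proof cases
        case (const c)
        then show ?thesis using False by auto
      next
        case g: (point a b)
        obtain r s where a: "a = Elt r s" using g by (cases a) auto
        \<comment> \<open>Only row \<open>i\<close> of column \<open>k\<close> can be sent to
          \<open>a\<close>; it misses \<open>a\<close> when \<open>p\<close> and \<open>s\<close>
          differ, and then the product is zero.\<close>
        then obtain i where i: "i \<in> {1..n}" "\<sigma> i = r"
          using f g perm_on_preimage[of \<sigma> n r] by auto
        show ?thesis
        proof (rule shapes_pointI[OF fg, of "Elt i k"])
          fix x assume "x \<in> B n" "x \<noteq> Elt i k"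
          then show "left_comp n f g x = Theta"
            using f g a i M_in_B[OF fM, of x] by (cases x) (auto simp: perm_on_eq_iff[of \<sigma> n])
        qed (use f i in auto)
      next
        case g: (column l q \<tau>)
        show ?thesis
        proof (cases "p = l")
          case True
          show ?thesis
          proof (rule shapes_columnI[OF fg, of k q "\<tau> \<circ> \<sigma>"])
            show "perm_on n (\<tau> \<circ> \<sigma>)" using f g by (auto intro: bij_betw_trans)
            fix x assume "x \<in> B n"
            then show "left_comp n f g x = column_map n k q (\<tau> \<circ> \<sigma>) x"
              using f g True perm_on_mem[of \<sigma> n] by (cases x) auto
          qed (use f g in auto)
        next
          case False
          show ?thesis
          proof (rule shapes_constI[OF fg, of Theta])
            fix x assume "x \<in> B n"
            then show "left_comp n f g x = Theta"
              using f g False perm_on_mem[of \<sigma> n] by (cases x) auto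
          qed
        qed
      qed
    qed
  qed
qed

section \<open>Identification of \<open>A_plus n\<close> with the three kinds of maps\<close>

text \<open>By injectivity of \<open>\<sigma>\<close>, the second coordinate
  \<open>\<sigma> j\<close> meets \<open>\<sigma> k\<close> only for \<open>j = k\<close>. As
  \<open>\<sigma>\<close> is onto, every nonzero constant has the form used here.\<close>

lemma auto_map_add_const_map:
  assumes "perm_on n \<sigma>" "k \<in> {1..n}" "q \<in> {1..n}"
  shows "pointwise_add n (auto_map n \<sigma>) (const_map n (Elt (\<sigma> k) q)) = column_map n k q \<sigma>"
proof (rule M_eqI[where n=n])
  show "pointwise_add n (auto_map n \<sigma>) (const_map n (Elt (\<sigma> k) q)) \<in> M n"
    using assms perm_on_mem[of \<sigma> n k]
    by (intro pointwise_add_in_M auto_map_in_M const_map_in_M) auto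
  show "column_map n k q \<sigma> \<in> M n" using assms by (intro column_map_in_M)
  fix x assume "x \<in> B n"
  then show "pointwise_add n (auto_map n \<sigma>) (const_map n (Elt (\<sigma> k) q)) x = column_map n k q \<sigma> x"
    using assms by (cases x) (auto simp: perm_on_eq_iff[of \<sigma> n])
qed

lemma affine_maps_shapes: "affine_maps n \<subseteq> shapes n"
proof
  fix f assume "f \<in> affine_maps n"
  then obtain g c where f: "f = pointwise_add n g (const_map n c)"
    and g: "g \<in> endomorphisms n" and c: "c \<in> B n"
    by (auto simp: affine_maps_def constant_maps_eq)
  from g show "f \<in> shapes n"
  proof (cases rule: endomorphism_cases)
    case (1 d)
    then show ?thesis using f c by (simp add: shapes_add shapes.const)
  next
    case (2 \<sigma>)
    show ?thesis
    proof (cases c)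
      case Theta
      show ?thesis
        unfolding f using 2 Theta
        by (intro shapes_constI[of _ _ Theta] pointwise_add_in_M)
          (auto simp: auto_map_in_M const_map_in_M)
    next
      case (Elt r q)
      then obtain k where "k \<in> {1..n}" "\<sigma> k = r"
        using 2 c perm_on_preimage[of \<sigma> n r] by auto
      then show ?thesis
        using f 2 c Elt auto_map_add_const_map[of \<sigma> n k q] by (auto intro: shapes.column)
    qed
  qed
qed

lemma A_plus_shapes: "A_plus n \<subseteq> shapes n"
proof
  fix f assume "f \<in> A_plus n"
  then show "f \<in> shapes n"
    by induction (use affine_maps_shapes in \<open>auto intro: shapes_add shapes_comp\<close>)
qed

lemma affineI:
  "g \<in> endomorphisms n \<Longrightarrow> c \<in> B n \<Longrightarrow> pointwise_add n g (const_map n c) \<in> A_plus n"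
  by (rule A_plus.affine) (auto simp: affine_maps_def constant_maps_eq)

lemma const_map_A_plus:
  assumes "c \<in> B n"
  shows "const_map n c \<in> A_plus n"
proof -
  \<comment> \<open>An idempotent left identity of \<open>c\<close>: its constant map is an
    endomorphism, and adding \<open>c\<close> to it makes \<open>const_map n c\<close>
    affine.\<close>
  obtain e where e: "e \<in> B n" "e \<oplus>\<^sub>B e = e" "e \<oplus>\<^sub>B c = c"
  proof (cases c)
    case Theta
    then show ?thesis using that[of Theta] by simp
  next
    case (Elt i j)
    then show ?thesis using that[of "Elt i i"] assms by simp
  qed
  have "const_map n c = pointwise_add n (const_map n e) (const_map n c)"
    using assms e by (intro M_eqI[where n=n] pointwise_add_in_M const_map_in_M) auto
  then show ?thesis
    using affineI[OF const_map_endomorphism[OF e(1,2)] assms] by simp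
qed

lemma column_map_A_plus:
  assumes "k \<in> {1..n}" "q \<in> {1..n}" "perm_on n \<sigma>"
  shows "column_map n k q \<sigma> \<in> A_plus n"
  using affineI[OF auto_map_endomorphism[OF assms(3)], of "Elt (\<sigma> k) q"]
    auto_map_add_const_map[of \<sigma> n k q] perm_on_mem[of \<sigma> n k] assms by simp

lemma point_map_A_plus:
  assumes a: "a \<in> B n" "a \<noteq> Theta" and b: "b \<in> B n"
  shows "point_map n a b \<in> A_plus n"
proof (cases b)
  case Theta
  have "point_map n a b = const_map n Theta"
    using a b Theta by (intro M_eqI[where n=n] point_map_in_M const_map_in_M) auto
  then show ?thesis by (simp add: const_map_A_plus)
next
  case (Elt r p)
  obtain i k where ik: "a = Elt i k" using a by (cases a) auto
  \<comment> \<open>In column \<open>k\<close> the second summand takes the values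
    \<open>Elt j p\<close>; adding \<open>Elt r i\<close> on the left keeps only the row
    \<open>j = i\<close> and gives \<open>Elt r p\<close>, which is \<open>b\<close>.\<close>
  have "point_map n a b = pointwise_add n (const_map n (Elt r i)) (column_map n k p id)"
  proof (rule M_eqI[where n=n])
    fix x assume "x \<in> B n"
    then show "point_map n a b x =
        pointwise_add n (const_map n (Elt r i)) (column_map n k p id) x"
      using a b Elt ik by (cases x) auto
  qed (use a b Elt ik in
      \<open>auto intro!: point_map_in_M pointwise_add_in_M const_map_in_M column_map_in_M\<close>)
  then show ?thesis
    using a b Elt ik by (auto intro!: A_plus.add const_map_A_plus column_map_A_plus)
qed

lemma A_plus_eq_shapes: "A_plus n = shapes n"
proof
  show "shapes n \<subseteq> A_plus n"
    by (auto elim!: shapes.cases intro: const_map_A_plus point_map_A_plus column_map_A_plus)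
qed (rule A_plus_shapes)

section \<open>Regularity and products of idempotents\<close>

text \<open>Constant maps, and point maps with value \<open>Theta\<close>, serve as their own
  inverses. The other point maps are inverted by exchanging \<open>a\<close> and \<open>b\<close>,
  column maps by exchanging the columns and inverting the permutation.\<close>

lemma shapes_regular:
  assumes f: "f \<in> shapes n"
  shows "\<exists>g\<in>shapes n. left_comp n (left_comp n f g) f = f"
proof -
  have fM: "f \<in> M n" using f by (rule shapes_in_M)
  have eqI: "left_comp n (left_comp n f g) f = f"
    if "g \<in> shapes n" "\<And>x. x \<in> B n \<Longrightarrow> f (g (f x)) = f x" for g
    using that by (intro M_eqI[where n=n] left_comp_in_M fM shapes_in_M) auto
  show ?thesis
    using f
  proof cases
    case (const c)
    show ?thesis using f const by (intro bexI[of _ f] eqI) auto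
  next
    case (point a b)
    show ?thesis
    proof (cases "b = Theta")
      case True
      then show ?thesis using f point by (intro bexI[of _ f] eqI) auto
    next
      case False
      then have "point_map n b a \<in> shapes n" using point by (intro shapes.point)
      then show ?thesis using point False by (intro bexI[of _ "point_map n b a"] eqI) auto
    qed
  next
    case (column k p \<sigma>)
    let ?\<tau> = "the_inv_into {1..n} \<sigma>"
    have g: "column_map n p k ?\<tau> \<in> shapes n"
      using column by (intro shapes.column bij_betw_the_inv_into) auto
    have inv: "?\<tau> (\<sigma> i) = i" if "i \<in> {1..n}" for i
      using column that by (intro the_inv_into_f_f) (auto simp: bij_betw_def)
    have "f (column_map n p k ?\<tau> (f x)) = f x" if "x \<in> B n" for x
      using that column inv perm_on_mem[of \<sigma> n] by (cases x) auto
    with g show ?thesis by (intro bexI[of _ "column_map n p k ?\<tau>"] eqI)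
  qed
qed

text \<open>A nonzero value of a column map determines the row through the permutation, and the
  column is \<open>k\<close>. This allows \<open>f\<close> to be cancelled from
  \<open>f (f x) = f x\<close>.\<close>

lemma shapes_partial_injective:
  assumes "f \<in> shapes n" "f \<notin> const_map n ` B n"
  shows "f Theta = Theta"
    and "x \<in> B n \<Longrightarrow> y \<in> B n \<Longrightarrow> f x = f y \<Longrightarrow> f x \<noteq> Theta \<Longrightarrow> x = y"
proof -
  show "f Theta = Theta" using assms(1) by cases (use assms(2) in auto)
  show "x = y" if "x \<in> B n" "y \<in> B n" "f x = f y" "f x \<noteq> Theta"
    using assms(1)
  proof cases
    case (const c)
    then show ?thesis using assms by auto
  next
    case (point a b)
    then show ?thesis using that by (auto split: if_splits)
  next
    case (column k p \<sigma>)
    then show ?thesis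
      using that by (cases x; cases y) (auto simp: perm_on_eq_iff[of \<sigma> n] split: if_splits)
  qed
qed

lemma idempotent_partial_identity:
  assumes f: "f \<in> shapes n" "left_comp n f f = f" and nc: "f \<notin> const_map n ` B n"
    and x: "x \<in> B n"
  shows "f x = x \<or> f x = Theta"
proof -
  have "f (f x) = f x" using f(2) x by (metis left_comp_apply)
  then show ?thesis
    using shapes_partial_injective(2)[OF f(1) nc, of "f x" x] M_in_B[OF shapes_in_M[OF f(1)] x] x
    by auto
qed

lemma shapes_idempotents_closed:
  assumes f: "f \<in> shapes n" "left_comp n f f = f" and g: "g \<in> shapes n" "left_comp n g g = g"
  shows "left_comp n (left_comp n f g) (left_comp n f g) = left_comp n f g"
proof (rule M_eqI[where n=n])
  show fg: "left_comp n f g \<in> M n"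
    using f g by (intro left_comp_in_M shapes_in_M)
  then show "left_comp n (left_comp n f g) (left_comp n f g) \<in> M n"
    using left_comp_in_M by blast
  fix x assume x: "x \<in> B n"
  have B: "f x \<in> B n" "g (f x) \<in> B n"
    using M_in_B[OF shapes_in_M[OF f(1)]] M_in_B[OF shapes_in_M[OF g(1)]] x by simp_all
  \<comment> \<open>A constant factor makes both sides the same constant. Otherwise \<open>f\<close>
    and \<open>g\<close> each keep their argument or send it to \<open>Theta\<close>, which both
    fix.\<close>
  then have "g (f (g (f x))) = g (f x)"
  proof (cases "f \<in> const_map n ` B n \<or> g \<in> const_map n ` B n")
    case True
    then show ?thesis using x B M_in_B[OF shapes_in_M[OF f(1)]] by auto
  next
    case False
    then show ?thesis
      using idempotent_partial_identity[OF f, of x] idempotent_partial_identity[OF g, of "f x"]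
        shapes_partial_injective(1)[OF f(1)] shapes_partial_injective(1)[OF g(1)] x B
      by auto
  qed
  then show "left_comp n (left_comp n f g) (left_comp n f g) x = left_comp n f g x"
    using x B by simp
qed

theorem theorem4p10:
  fixes n :: nat
  assumes "n \<ge> 1"
  shows "orthodox_semigroup (A_plus n) (left_comp n)"
proof -
  \<comment> \<open>The zero map witnesses that the semigroup and its set of idempotents are
    nonempty.\<close>
  have zero: "const_map n Theta \<in> shapes n"
    by (simp add: shapes.const)
  have "left_comp n (const_map n Theta) (const_map n Theta) = const_map n Theta"
    by (intro M_eqI[where n=n] left_comp_in_M const_map_in_M) auto
  with zero have "const_map n Theta \<in> idempotents (shapes n) (left_comp n)"
    by (simp add: idempotents_def)
  then have "subsemigroup_of (idempotents (shapes n) (left_comp n)) (shapes n) (left_comp n)"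
    unfolding subsemigroup_of_def
    by (auto simp: idempotents_def shapes_comp shapes_idempotents_closed)
  moreover have "semigroup_on (shapes n) (left_comp n)"
    unfolding semigroup_on_def using zero
    by (auto simp: shapes_comp left_comp_assoc shapes_in_M)
  ultimately show ?thesis
    by (simp add: A_plus_eq_shapes orthodox_semigroup_def regular_semigroup_def shapes_regular)
qed

end
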